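(* Let $\mathcal{J}, \mathcal{K} \subset \mathbb{R}^{n}$ be convex sets such that $\mathcal{J}$ is compact and $\mathcal{J} \oplus \mathcal{K}$ is a free sum. Suppose moreover that $\operatorname{llenv} \operatorname{cone} \mathcal{J} = (\operatorname{lenv} \operatorname{cone} \mathcal{J}) \cap \mathbb{Z}^{n+1}$. Then, as formal Laurent series, $$\sigma_{\operatorname{cone}(\mathcal{J} \oplus \mathcal{K})}(\mathbf{z}) = (1 - z_{n+1})\, \sigma_{\operatorname{cone} \mathcal{J}}(\mathbf{z})\, \sigma_{\operatorname{cone} \mathcal{K}}(\mathbf{z}).$$
   Context: For convex $\mathcal{J},\mathcal{K}\subset\mathbb{R}^n$, $\mathcal{J}\oplus\mathcal{K}:=\operatorname{conv}(\mathcal{J}\cup\mathcal{K})$. We say "$\mathcal{J}\oplus\mathcal{K}$ is a free sum" if there is $g\in\mathsf{SL}_n(\mathbb{Z})$ such that $g\mathcal{J}$ and $g\mathcal{K}$ each contain the origin and their linear spans are orthogonal coordinate subspaces (subspaces spanned by subsets of the standard basis vectors $e_1,\dots,e_n$). Let $\alpha:\mathbb{R}^n\to\mathbb{R}^{n+1}$, $\alpha(a)=(a,1)$. For convex $\mathcal{K}\subset\mathbb{R}^n$, $\operatorname{cone}\mathcal{K}\subset\mathbb{R}^{n+1}$ is the set of all nonnegative scalar multiples of elements of $\alpha(\mathcal{K})$. For $S\subset\mathbb{R}^{n+1}$, $\sigma_S(\mathbf{z})=\sum_{m\in S\cap\mathbb{Z}^{n+1}} z_1^{m_1}\cdots z_{n+1}^{m_{n+1}}$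 (formal Laurent series). For a closed linear cone $\mathcal{C}\subset\mathbb{R}^{n+1}$ not containing $-e_{n+1}$, define $\epsilon_{\mathcal{C}}:\mathcal{C}\to\mathcal{C}$ by $\epsilon_{\mathcal{C}}(x)=x-\max\{\lambda\in\mathbb{R}: x-\lambda e_{n+1}\in\mathcal{C}\}\,e_{n+1}$; the lower envelope is $\operatorname{lenv}\mathcal{C}:=\epsilon_{\mathcal{C}}(\mathcal{C})$ and the lower lattice envelope is $\operatorname{llenv}\mathcal{C}:=\epsilon_{\mathcal{C}}(\mathcal{C}\cap\mathbb{Z}^{n+1})$. *)

theory Defs
  imports "HOL-Analysis.Analysis"
begin

text \<open>
  \<open>\<real>\<^sup>n\<close> is \<^typ>\<open>real ^ 'n\<close> and \<open>\<real>\<^sup>n\<^sup>+\<^sup>1\<close> is \<^typ>\<open>(real ^ 'n) \<times> real\<close>, the second component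
  being the last coordinate; exponents of monomials live in \<^typ>\<open>(int ^ 'n) \<times> int\<close>.
\<close>

definition direct_sum :: "(real ^ 'n) set \<Rightarrow> (real ^ 'n) set \<Rightarrow> (real ^ 'n) set"
    (infixl "\<oplus>" 65) where
  "J \<oplus> K = convex hull (J \<union> K)"

definition SL_int :: "(real ^ 'n ^ 'n) set" where
  "SL_int = {g. (\<forall>i j. g $ i $ j \<in> \<int>) \<and> det g = 1}"

definition coordinate_subspace :: "(real ^ 'n) set \<Rightarrow> bool" where
  "coordinate_subspace V \<longleftrightarrow> (\<exists>I. V = span ((\<lambda>i. axis i 1) ` I))"

definition is_free_sum :: "(real ^ 'n) set \<Rightarrow> (real ^ 'n) set \<Rightarrow> bool" where
  "is_free_sum J K \<longleftrightarrow>
     (\<exists>g \<in> SL_int.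
        0 \<in> (*v) g ` J \<and> 0 \<in> (*v) g ` K \<and>
        coordinate_subspace (span ((*v) g ` J)) \<and>
        coordinate_subspace (span ((*v) g ` K)) \<and>
        (\<forall>x \<in> span ((*v) g ` J). \<forall>y \<in> span ((*v) g ` K). orthogonal x y))"

definition lift :: "real ^ 'n \<Rightarrow> (real ^ 'n) \<times> real" where
  "lift a = (a, 1)"

definition cone_over :: "(real ^ 'n) set \<Rightarrow> ((real ^ 'n) \<times> real) set" where
  "cone_over K = {c *\<^sub>R x | c x. 0 \<le> c \<and> x \<in> lift ` K}"

definition of_int_point :: "(int ^ 'n) \<times> int \<Rightarrow> (real ^ 'n) \<times> real" where
  "of_int_point m = ((\<chi> i. of_int (fst m $ i)), of_int (snd m))"

definition int_lattice :: "((real ^ 'n) \<times> real) set" where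
  "int_lattice = range of_int_point"

definition e_last :: "(real ^ 'n) \<times> real" where
  "e_last = (0, 1)"

text \<open>
  \<^const>\<open>Greatest\<close> denotes an attained maximum.  It exists for every \<open>x \<in> C\<close> when \<open>C\<close> is a closed
  cone with \<open>- e_last \<notin> C\<close>; otherwise the value may be unspecified.
\<close>

definition eps :: "((real ^ 'n) \<times> real) set \<Rightarrow> (real ^ 'n) \<times> real \<Rightarrow> (real ^ 'n) \<times> real" where
  "eps C x = x - (GREATEST t. x - t *\<^sub>R e_last \<in> C) *\<^sub>R e_last"

definition lenv :: "((real ^ 'n) \<times> real) set \<Rightarrow> ((real ^ 'n) \<times> real) set" where
  "lenv C = eps C ` C"

definition llenv :: "((real ^ 'n) \<times> real) set \<Rightarrow> ((real ^ 'n) \<times> real) set" where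
  "llenv C = eps C ` (C \<inter> int_lattice)"

text \<open>
  A formal Laurent series in \<open>z\<^sub>1, \<dots>, z\<^sub>n\<^sub>+\<^sub>1\<close> is its coefficient function, with no restriction on
  the support.  Addition and subtraction are pointwise.  The product of two series is only
  meaningful if each coefficient of the Cauchy product is a finite sum.
\<close>

type_synonym 'n laurent = "(int ^ 'n) \<times> int \<Rightarrow> int"

definition monomial :: "(int ^ 'n) \<times> int \<Rightarrow> 'n::finite laurent" where
  "monomial m = (\<lambda>k. if k = m then 1 else 0)"

definition one_laurent :: "'n::finite laurent" where
  "one_laurent = monomial 0"

definition z_last :: "'n::finite laurent" where
  "z_last = monomial (0, 1)"

definition mult_defined :: "'n::finite laurent \<Rightarrow> 'n laurent \<Rightarrow> bool" where
  "mult_defined f g \<longleftrightarrow> (\<forall>m. finite {a. f a \<noteq> 0 \<and> g (m - a) \<noteq> 0})"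

definition mult_laurent :: "'n laurent \<Rightarrow> 'n laurent \<Rightarrow> 'n::finite laurent" (infixl "\<star>" 70) where
  "f \<star> g = (\<lambda>m. \<Sum>a \<in> {a. f a \<noteq> 0 \<and> g (m - a) \<noteq> 0}. f a * g (m - a))"

text \<open>The coefficient of \<open>z\<^sup>m\<close> in \<open>\<sigma>\<^sub>S\<close> is 1 if \<open>m\<close> lies in \<open>S\<close> and 0 otherwise.\<close>

definition sigma_series :: "((real ^ 'n) \<times> real) set \<Rightarrow> 'n::finite laurent" where
  "sigma_series S = (\<lambda>m. if of_int_point m \<in> S then 1 else 0)"

lemma mult_defined_one_minus_z_last:
  "mult_defined (one_laurent - z_last) (f :: 'n::finite laurent)"
  unfolding mult_defined_def
proof
  fix m :: "(int ^ 'n) \<times> int"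
  have "{a. (one_laurent - z_last) a \<noteq> 0 \<and> f (m - a) \<noteq> 0} \<subseteq> {0, (0, 1)}"
    by (auto simp: one_laurent_def z_last_def monomial_def split: if_splits)
  then show "finite {a. (one_laurent - z_last) a \<noteq> 0 \<and> f (m - a) \<noteq> 0}"
    by (rule finite_subset) simp
qed

end

(*
  Since J is compact and contains 0, the fibre of cone J over a point v is a closed ray [p(v), \<infinity>)
  or empty, and the condition on the lower envelopes says that p(v) is an integer for integral v.
  Because the sum is free, an integral point of span J + span K splits uniquely into integral
  parts.  Hence the coefficient of \<sigma>_{cone J} \<sigma>_{cone K} at m counts the splittings m = a + b with
  a in cone J and b in cone K, and multiplying by 1 - z_{n+1} leaves only those with a on the lower
  envelope of cone J.  There is exactly one of these when m lies in cone J + cone K = cone (J \<oplus> K),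
  and none otherwise.
*)
theory Submission
  imports Defs
begin

section \<open>Integral vectors and unimodular matrices\<close>

definition integral_vec :: "real ^ 'n \<Rightarrow> bool" where
  "integral_vec v \<longleftrightarrow> (\<forall>i. v $ i \<in> \<int>)"

lemma det_in_Ints:
  fixes A :: "real ^ 'n ^ 'n"
  assumes "\<And>i j. A $ i $ j \<in> \<int>"
  shows "det A \<in> \<int>"
  unfolding det_def by (intro Ints_sum Ints_mult Ints_prod assms) simp

lemma SL_int_nonzero_det: "g \<in> SL_int \<Longrightarrow> det g \<noteq> 0"
  by (simp add: SL_int_def)

lemma SL_int_mult_eq_0_iff:
  fixes g :: "real ^ 'n ^ 'n"
  assumes "g \<in> SL_int"
  shows "g *v x = 0 \<longleftrightarrow> x = 0"
  using SL_int_nonzero_det[OF assms] invertible_det_nz[of g] invertible_left_inverse[of g]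
    matrix_left_invertible_ker[of g]
  by auto

text \<open>Passage from \<open>g *v x\<close> back to \<open>x\<close> is Cramer's rule. Since
  \<open>det g = 1\<close>, each coordinate of \<open>x\<close> is itself the determinant of a
  matrix with integer entries.\<close>

lemma SL_int_integral_vec_iff:
  fixes g :: "real ^ 'n ^ 'n"
  assumes g: "g \<in> SL_int"
  shows "integral_vec (g *v x) \<longleftrightarrow> integral_vec x"
proof
  assume "integral_vec x"
  then show "integral_vec (g *v x)"
    using g by (auto simp: integral_vec_def SL_int_def matrix_vector_mult_def)
next
  assume b: "integral_vec (g *v x)"
  have "x = (\<chi> k. det (\<chi> i j. if j = k then (g *v x) $ i else g $ i $ j) / det g)"
    using cramer[OF SL_int_nonzero_det[OF g], of x "g *v x"] by simp
  then have "x $ k = det (\<chi> i j. if j = k then (g *v x) $ i else g $ i $ j)" for k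
    using g unfolding SL_int_def by (simp add: vec_eq_iff)
  moreover have "det (\<chi> i j. if j = k then (g *v x) $ i else g $ i $ j) \<in> \<int>" for k
    by (rule det_in_Ints) (use b g in \<open>auto simp: integral_vec_def SL_int_def\<close>)
  ultimately show "integral_vec x"
    by (simp add: integral_vec_def)
qed

lemma of_int_point_add: "of_int_point (a + b) = of_int_point a + of_int_point b"
  by (simp add: of_int_point_def vec_eq_iff)

lemma of_int_point_diff: "of_int_point (a - b) = of_int_point a - of_int_point b"
  by (simp add: of_int_point_def vec_eq_iff)

lemma of_int_point_zero_one: "of_int_point (0, 1) = e_last"
  by (simp add: of_int_point_def e_last_def vec_eq_iff)

lemma integral_vec_fst_of_int_point: "integral_vec (fst (of_int_point a))"
  by (simp add: of_int_point_def integral_vec_def)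

lemma int_lattice_iff: "x \<in> int_lattice \<longleftrightarrow> integral_vec (fst x) \<and> snd x \<in> \<int>"
proof
  assume "x \<in> int_lattice"
  then show "integral_vec (fst x) \<and> snd x \<in> \<int>"
    by (auto simp: int_lattice_def of_int_point_def integral_vec_def)
next
  assume x: "integral_vec (fst x) \<and> snd x \<in> \<int>"
  then have "x = of_int_point (\<chi> i. \<lfloor>fst x $ i\<rfloor>, \<lfloor>snd x\<rfloor>)"
    by (simp add: of_int_point_def integral_vec_def prod_eq_iff vec_eq_iff)
  then show "x \<in> int_lattice"
    unfolding int_lattice_def by (rule range_eqI)
qed

section \<open>Cones over convex sets containing the origin\<close>

lemma cone_over_iff: "(v, t) \<in> cone_over K \<longleftrightarrow> 0 \<le> t \<and> (\<exists>x\<in>K. v = t *\<^sub>R x)"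
  by (force simp: cone_over_def lift_def)

lemma cone_over_subset_span: "(v, t) \<in> cone_over K \<Longrightarrow> v \<in> span K"
  by (auto simp: cone_over_iff intro: span_mul span_base)

text \<open>A point at height \<open>s > 0\<close> over \<open>x\<close> is also the point at height
  \<open>t\<close> over \<open>(s / t) *\<^sub>R x\<close>, which lies on the segment from 0 to
  \<open>x\<close> and hence in \<open>K\<close>. So every fibre over a fixed \<open>v\<close> is
  closed upwards.\<close>

lemma cone_over_upward:
  assumes "convex K" "0 \<in> K" "(v, s) \<in> cone_over K" "s \<le> t"
  shows "(v, t) \<in> cone_over K"
proof (cases "t = 0")
  case True
  with assms(3,4) show ?thesis by (auto simp: cone_over_iff)
next
  case False
  from assms(3) obtain x where x: "0 \<le> s" "x \<in> K" "v = s *\<^sub>R x"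
    by (auto simp: cone_over_iff)
  have "(1 - s / t) *\<^sub>R 0 + (s / t) *\<^sub>R x \<in> K"
    using assms x False by (intro convexD) auto
  then show ?thesis
    using assms(4) x False by (auto simp: cone_over_iff intro!: bexI[of _ "(s / t) *\<^sub>R x"])
qed

text \<open>Lifting to height 1 keeps the compact base away from the origin, so its conic hull has
  no limit points missing.\<close>

lemma closed_cone_over:
  assumes "compact K"
  shows "closed (cone_over K)"
proof -
  have "cone_over K = conic hull (lift ` K)"
    by (simp add: cone_over_def conic_hull_explicit)
  moreover have "compact (lift ` K)"
    unfolding lift_def by (intro compact_continuous_image continuous_intros assms)
  moreover have "0 \<notin> lift ` K"
    by (auto simp: lift_def zero_prod_def)
  ultimately show ?thesis
    using closed_conic_hull by metis
qed

text \<open>The fibre over \<open>v\<close> is a closed set of heights bounded below by 0, so it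
  contains its infimum.\<close>

lemma cone_over_least_height:
  assumes "compact K" and "(v, t) \<in> cone_over K"
  obtains p where "(v, p) \<in> cone_over K" and "\<And>s. (v, s) \<in> cone_over K \<Longrightarrow> p \<le> s"
proof -
  let ?F = "{s. (v, s) \<in> cone_over K}"
  have "closed ((\<lambda>s. (v, s)) -` cone_over K)"
    by (intro closed_vimage closed_cone_over assms continuous_intros)
  then have "closed ?F"
    by (simp add: vimage_def)
  moreover have "?F \<noteq> {}" using assms by auto
  moreover have "bdd_below ?F"
    by (rule bdd_belowI[of _ 0]) (auto simp: cone_over_iff)
  ultimately have "Inf ?F \<in> ?F" "\<And>s. s \<in> ?F \<Longrightarrow> Inf ?F \<le> s"
    using closed_contains_Inf[of ?F] cInf_lower[of _ ?F] by blast+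
  then show ?thesis using that by blast
qed

text \<open>Lowering by \<open>r\<close> reaches height \<open>t - r\<close>, so the greatest
  \<open>r\<close> corresponds to the least height of the fibre. The value therefore depends on
  \<open>v\<close> alone.\<close>

lemma eps_eq:
  assumes "(v, p) \<in> C" and "\<And>s. (v, s) \<in> C \<Longrightarrow> p \<le> s"
  shows "eps C (v, t) = (v, p)"
proof -
  have "(GREATEST r. (v, t) - r *\<^sub>R e_last \<in> C) = t - p"
    by (rule Greatest_equality) (use assms in \<open>force simp: e_last_def\<close>)+
  then show ?thesis by (simp add: eps_def e_last_def)
qed

text \<open>A convex combination with weights \<open>a\<close>, \<open>b\<close> at height
  \<open>c\<close> splits into points at heights \<open>c * a\<close> and \<open>c * b\<close>.
  Conversely, heights \<open>c\<close> and \<open>d\<close> normalise to the weights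
  \<open>c / (c + d)\<close> and \<open>d / (c + d)\<close>.\<close>

lemma cone_over_direct_sum_iff:
  assumes "convex J" "convex K" "0 \<in> J" "0 \<in> K"
  shows "z \<in> cone_over (J \<oplus> K) \<longleftrightarrow> (\<exists>x\<in>cone_over J. \<exists>y\<in>cone_over K. z = x + y)"
proof
  assume "z \<in> cone_over (J \<oplus> K)"
  then obtain c w where c: "0 \<le> c" "w \<in> convex hull (J \<union> K)" "z = (c *\<^sub>R w, c)"
    by (cases z) (auto simp: cone_over_iff direct_sum_def)
  have "J \<noteq> {}" "K \<noteq> {}"
    using assms by auto
  with c obtain x y a b where u: "x \<in> J" "y \<in> K" "0 \<le> a" "0 \<le> b" "w = a *\<^sub>R x + b *\<^sub>R y" "a + b = 1"
    using convex_hull_union_two[of J K] assms by auto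
  have "((c * a) *\<^sub>R x, c * a) \<in> cone_over J" "((c * b) *\<^sub>R y, c * b) \<in> cone_over K"
    using c u by (auto simp: cone_over_iff)
  moreover have "z = ((c * a) *\<^sub>R x, c * a) + ((c * b) *\<^sub>R y, c * b)"
    using c u by (simp add: scaleR_add_right flip: distrib_left)
  ultimately show "\<exists>x\<in>cone_over J. \<exists>y\<in>cone_over K. z = x + y" by blast
next
  assume "\<exists>x\<in>cone_over J. \<exists>y\<in>cone_over K. z = x + y"
  then obtain c x d y where c: "0 \<le> c" "x \<in> J" "0 \<le> d" "y \<in> K"
    "z = (c *\<^sub>R x + d *\<^sub>R y, c + d)"
    by (force simp: cone_over_def lift_def)
  show "z \<in> cone_over (J \<oplus> K)"
  proof (cases "c + d = 0")
    case True
    \<comment> \<open>The weights cannot be normalised here, but both summands are then the apex of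
      the cone.\<close>
    with c have "c = 0" "d = 0" by auto
    then show ?thesis
      using c hull_inc[of x "J \<union> K"] by (auto simp: cone_over_iff direct_sum_def)
  next
    case False
    with c have pos: "c + d > 0" by auto
    let ?w = "(c / (c + d)) *\<^sub>R x + (d / (c + d)) *\<^sub>R y"
    have "?w \<in> convex hull (J \<union> K)"
      using c pos
      by (intro convexD[OF convex_convex_hull] hull_inc) (auto simp flip: add_divide_distrib)
    moreover have "c *\<^sub>R x + d *\<^sub>R y = (c + d) *\<^sub>R ?w"
      using pos by (simp add: scaleR_add_right)
    ultimately show ?thesis
      using c by (auto simp: cone_over_iff direct_sum_def simp del: scaleR_add_right)
  qed
qed

section \<open>Free sums\<close>

lemma free_sum_zero_mem:
  assumes "is_free_sum J K"
  shows "0 \<in> J" "0 \<in> K"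
proof -
  from assms obtain g where g: "g \<in> SL_int" "0 \<in> (*v) g ` J" "0 \<in> (*v) g ` K"
    unfolding is_free_sum_def by auto
  have "x = 0" if "g *v x = 0" for x
    using SL_int_mult_eq_0_iff[OF g(1)] that by simp
  with g(2,3) show "0 \<in> J" "0 \<in> K" by force+
qed

text \<open>The image \<open>g *v v\<close> lies in two orthogonal subspaces, so it is orthogonal to
  itself.\<close>

lemma free_sum_span_Int:
  assumes "is_free_sum J K" "v \<in> span J" "v \<in> span K"
  shows "v = 0"
proof -
  from assms obtain g where g: "g \<in> SL_int"
    "\<forall>x \<in> span ((*v) g ` J). \<forall>y \<in> span ((*v) g ` K). orthogonal x y"
    unfolding is_free_sum_def by auto
  have "g *v v \<in> span ((*v) g ` J)" "g *v v \<in> span ((*v) g ` K)"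
    using assms by (auto simp: span_linear_image matrix_vector_mul_linear)
  with g(2) have "g *v v = 0"
    using orthogonal_self by blast
  then show ?thesis
    by (simp add: SL_int_mult_eq_0_iff[OF g(1)])
qed

text \<open>After applying \<open>g\<close>, the part from \<open>K\<close> vanishes at the
  coordinates in \<open>I\<close>, by orthogonality to the unit vectors there, and the part from
  \<open>J\<close> vanishes outside \<open>I\<close>. Each coordinate of \<open>g *v v\<close> is
  thus 0 or a coordinate of the integral vector \<open>g *v (v + w)\<close>.\<close>

lemma free_sum_integral_part:
  assumes "is_free_sum J K" "v \<in> span J" "w \<in> span K" "integral_vec (v + w)"
  shows "integral_vec v"
proof -
  from assms obtain g I where g: "g \<in> SL_int"
    "\<forall>x \<in> span ((*v) g ` J). \<forall>y \<in> span ((*v) g ` K). orthogonal x y"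
    and I: "span ((*v) g ` J) = span ((\<lambda>i. axis i 1) ` I)"
    unfolding is_free_sum_def coordinate_subspace_def by auto
  have gv: "g *v v \<in> span ((*v) g ` J)" and gw: "g *v w \<in> span ((*v) g ` K)"
    using assms by (auto simp: span_linear_image matrix_vector_mul_linear)
  have "integral_vec (g *v (v + w))"
    using assms(4) SL_int_integral_vec_iff[OF g(1)] by blast
  then have sum: "(g *v v) $ i + (g *v w) $ i \<in> \<int>" for i
    by (simp add: integral_vec_def matrix_vector_right_distrib)
  have "(g *v v) $ i \<in> \<int>" for i
  proof (cases "i \<in> I")
    case True
    then have "axis i 1 \<in> span ((*v) g ` J)"
      by (auto simp: I intro: span_base)
    with g(2) gw have "orthogonal (axis i 1) (g *v w)" by blast
    then have "(g *v w) $ i = 0"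
      by (simp add: orthogonal_def inner_axis')
    with sum[of i] show ?thesis by simp
  next
    case False
    have "subspace {x :: real ^ 'a. x $ i = 0}"
      by (auto simp: subspace_def)
    moreover have "(\<lambda>i. axis i 1) ` I \<subseteq> {x :: real ^ 'a. x $ i = 0}"
      using False by (auto simp: axis_def)
    ultimately have "(g *v v) $ i = 0"
      using gv span_minimal unfolding I by blast
    then show ?thesis by simp
  qed
  then show ?thesis
    using SL_int_integral_vec_iff[OF g(1), of v] by (simp add: integral_vec_def)
qed

lemma free_sum_unique:
  assumes "is_free_sum J K" "v \<in> span J" "v' \<in> span J" "u - v \<in> span K" "u - v' \<in> span K"
  shows "v = v'"
proof -
  have "v - v' \<in> span J" by (rule span_diff[OF assms(2,3)])
  moreover have "(u - v') - (u - v) \<in> span K" by (rule span_diff[OF assms(5,4)])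
  ultimately show ?thesis
    using free_sum_span_Int[OF assms(1), of "v - v'"] by simp
qed

section \<open>Laurent series\<close>

lemma one_minus_z_last_mult:
  "(one_laurent - z_last) \<star> f = (\<lambda>m. f m - f (m - (0, 1)))"
proof
  fix m :: "(int ^ 'a) \<times> int"
  let ?g = "one_laurent - z_last :: 'a laurent"
  \<comment> \<open>The two exponents must differ, or the sum over \<open>{0, (0, 1)}\<close> would
    collapse to a single term.\<close>
  have ne: "(0 :: (int ^ 'a) \<times> int) \<noteq> (0, 1)" by (simp add: zero_prod_def)
  have "(?g \<star> f) m = (\<Sum>a\<in>{0, (0, 1)}. ?g a * f (m - a))"
    unfolding mult_laurent_def
    by (rule sum.mono_neutral_left)
      (auto simp: one_laurent_def z_last_def monomial_def split: if_splits)
  also have "\<dots> = f m - f (m - (0, 1))"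
    using ne by (simp add: one_laurent_def z_last_def monomial_def)
  finally show "(?g \<star> f) m = f m - f (m - (0, 1))" .
qed

text \<open>The index set of the Cauchy product of two indicator series. Every term over it equals
  1, so a coefficient of the product is a cardinality.\<close>

definition splittings ::
    "((real ^ 'n) \<times> real) set \<Rightarrow> ((real ^ 'n) \<times> real) set \<Rightarrow> (int ^ 'n) \<times> int \<Rightarrow>
      ((int ^ 'n) \<times> int) set" where
  "splittings C D m = {a. of_int_point a \<in> C \<and> of_int_point (m - a) \<in> D}"

lemma sigma_series_support:
  "{a. sigma_series C a \<noteq> 0 \<and> sigma_series D (m - a) \<noteq> 0} = splittings C D m"
  by (auto simp: splittings_def sigma_series_def)

lemma sigma_series_mult:
  "(sigma_series C \<star> sigma_series D) m = int (card (splittings C D m))"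
  unfolding mult_laurent_def sigma_series_support
  by (simp add: splittings_def sigma_series_def)

text \<open>Translation by \<open>e_last\<close> embeds the splittings of \<open>m - (0, 1)\<close> into those of \<open>m\<close>; the ones
  it misses are those whose first part cannot be lowered.\<close>

lemma card_splittings_diff:
  assumes fin: "\<And>m. finite (splittings C D m)"
    and up: "\<And>x. x \<in> C \<Longrightarrow> x + e_last \<in> C"
  shows "int (card (splittings C D m)) - int (card (splittings C D (m - (0, 1)))) =
    int (card {a \<in> splittings C D m. of_int_point a - e_last \<notin> C})"
proof -
  let ?T = "(\<lambda>a. a + (0, 1)) ` splittings C D (m - (0, 1))"
  let ?B = "{a \<in> splittings C D m. of_int_point a - e_last \<notin> C}"
  have T: "?T = {a \<in> splittings C D m. of_int_point a - e_last \<in> C}"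
  proof (intro equalityI subsetI)
    fix b assume "b \<in> ?T"
    then obtain a where a: "of_int_point a \<in> C" "of_int_point (m - (0, 1) - a) \<in> D"
      and b: "b = a + (0, 1)"
      by (auto simp: splittings_def)
    have "m - b = m - (0, 1) - a"
      unfolding b by (simp only: diff_diff_eq add.commute)
    then have "of_int_point (m - b) \<in> D"
      using a(2) by (simp only:)
    moreover have "of_int_point b = of_int_point a + e_last"
      unfolding b by (simp only: of_int_point_add of_int_point_zero_one)
    ultimately show "b \<in> {a \<in> splittings C D m. of_int_point a - e_last \<in> C}"
      using a(1) by (simp add: splittings_def up)
  next
    fix b assume b: "b \<in> {a \<in> splittings C D m. of_int_point a - e_last \<in> C}"
    then have "b - (0, 1) \<in> splittings C D (m - (0, 1))"
      by (auto simp: splittings_def of_int_point_diff of_int_point_zero_one)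
    then show "b \<in> ?T"
      by (rule rev_image_eqI) simp
  qed
  have "splittings C D m = ?T \<union> ?B" "?T \<inter> ?B = {}"
    unfolding T by auto
  then have "card (splittings C D m) = card ?T + card ?B"
    using fin by (metis (no_types, lifting) card_Un_disjoint finite_Un)
  moreover have "card ?T = card (splittings C D (m - (0, 1)))"
    by (rule card_image) simp
  ultimately show ?thesis by simp
qed

section \<open>Splittings in a free sum\<close>

text \<open>The horizontal parts of \<open>a\<close> and \<open>m - a\<close> lie in the spans of
  \<open>J\<close> and \<open>K\<close>, which meet only in 0. Two splittings can thus differ only
  in how they share the height.\<close>

lemma splittings_fst_unique:
  assumes "is_free_sum J K"
    and "a \<in> splittings (cone_over J) (cone_over K) m"
    and "b \<in> splittings (cone_over J) (cone_over K) m"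
  shows "fst a = fst b"
proof -
  have span: "fst (of_int_point c) \<in> span J \<and> fst (of_int_point m) - fst (of_int_point c) \<in> span K"
    if "c \<in> splittings (cone_over J) (cone_over K) m" for c
    using that cone_over_subset_span[of "fst (of_int_point c)"]
      cone_over_subset_span[of "fst (of_int_point (m - c))"]
    unfolding splittings_def by (metis (mono_tags) fst_diff mem_Collect_eq of_int_point_diff prod.collapse)
  have "fst (of_int_point a) = fst (of_int_point b)"
    using free_sum_unique[OF assms(1)] span[OF assms(2)] span[OF assms(3)] by blast
  then show ?thesis
    by (simp add: of_int_point_def vec_eq_iff)
qed

text \<open>With the horizontal part fixed, only the height of the first part varies. It lies
  between 0 and \<open>snd m\<close>, because neither cone has points of negative height.\<close>

lemma finite_splittings:
  assumes "is_free_sum J K"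
  shows "finite (splittings (cone_over J) (cone_over K) m)" (is "finite ?A")
proof (cases "?A = {}")
  case False
  then obtain b where b: "b \<in> ?A" by blast
  have "?A \<subseteq> {fst b} \<times> {0..snd m}"
  proof
    fix a assume a: "a \<in> ?A"
    then have "0 \<le> real_of_int (snd a)" "0 \<le> real_of_int (snd (m - a))"
      by (auto simp: splittings_def of_int_point_def cone_over_iff)
    then have "0 \<le> snd a" "snd a \<le> snd m" by auto
    moreover have "fst a = fst b"
      using splittings_fst_unique[OF assms a b] .
    ultimately show "a \<in> {fst b} \<times> {0..snd m}"
      by (simp add: mem_Times_iff)
  qed
  then show ?thesis
    by (rule finite_subset) simp
qed simp

lemma minimal_splittings_unique:
  assumes "convex J" "0 \<in> J" "is_free_sum J K"
    and a: "a \<in> splittings (cone_over J) (cone_over K) m" "of_int_point a - e_last \<notin> cone_over J"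
    and b: "b \<in> splittings (cone_over J) (cone_over K) m" "of_int_point b - e_last \<notin> cone_over J"
  shows "a = b"
proof -
  have le: "snd d \<le> snd c" if "of_int_point c \<in> cone_over J" "of_int_point d - e_last \<notin> cone_over J"
    "fst c = fst d" for c d
  proof (rule ccontr)
    assume "\<not> snd d \<le> snd c"
    \<comment> \<open>By integrality, a strictly higher \<open>d\<close> is higher by at least 1.
      Then \<open>d\<close> lowered by \<open>e_last\<close> is still at or above \<open>c\<close>,
      hence in the cone.\<close>
    then have "real_of_int (snd c) \<le> real_of_int (snd d) - 1" by linarith
    then show False
      using cone_over_upward[OF assms(1,2)] that by (auto simp: of_int_point_def e_last_def)
  qed
  have "fst a = fst b"
    using splittings_fst_unique[OF assms(3) a(1) b(1)] .
  moreover have "snd a = snd b"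
    using le[of a b] le[of b a] a b calculation by (auto simp: splittings_def)
  ultimately show ?thesis by (simp add: prod_eq_iff)
qed

text \<open>This is where the envelope condition enters: \<open>eps\<close> sends a lattice point
  over \<open>v\<close> to the lowest point \<open>(v, p)\<close>, which must then be a lattice
  point as well.\<close>

lemma integral_least_height:
  assumes "convex J" "compact J" "0 \<in> J"
    and env: "llenv (cone_over J) = lenv (cone_over J) \<inter> int_lattice"
    and v: "(v, t) \<in> cone_over J" "integral_vec v"
  obtains p where "p \<in> \<int>" "(v, p) \<in> cone_over J" "\<And>s. (v, s) \<in> cone_over J \<Longrightarrow> p \<le> s"
proof -
  obtain p where p: "(v, p) \<in> cone_over J" "\<And>s. (v, s) \<in> cone_over J \<Longrightarrow> p \<le> s"
    using cone_over_least_height[OF assms(2) v(1)] by blast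
  \<comment> \<open>The height \<open>t\<close> may be fractional; rounding it up stays in the cone
    and gives a lattice point over \<open>v\<close>.\<close>
  have "(v, of_int \<lceil>t\<rceil>) \<in> cone_over J"
    using cone_over_upward[OF assms(1,3) v(1)] by simp
  then have "(v, of_int \<lceil>t\<rceil>) \<in> cone_over J \<inter> int_lattice"
    using v(2) by (simp add: int_lattice_iff)
  then have "eps (cone_over J) (v, of_int \<lceil>t\<rceil>) \<in> llenv (cone_over J)"
    unfolding llenv_def by (rule imageI)
  then have "(v, p) \<in> int_lattice"
    using env eps_eq[OF p] by auto
  then show ?thesis
    using that p by (auto simp: int_lattice_iff)
qed

lemma minimal_splitting_exists_iff:
  assumes "convex J" "convex K" "compact J" "is_free_sum J K"
    and env: "llenv (cone_over J) = lenv (cone_over J) \<inter> int_lattice"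
  shows "(\<exists>a \<in> splittings (cone_over J) (cone_over K) m. of_int_point a - e_last \<notin> cone_over J) \<longleftrightarrow>
    of_int_point m \<in> cone_over (J \<oplus> K)"
proof
  note zero = free_sum_zero_mem[OF assms(4)]
  note sum_iff = cone_over_direct_sum_iff[OF assms(1,2) zero]
  {
    assume "\<exists>a \<in> splittings (cone_over J) (cone_over K) m. of_int_point a - e_last \<notin> cone_over J"
    then obtain a where "of_int_point a \<in> cone_over J" "of_int_point (m - a) \<in> cone_over K"
      by (auto simp: splittings_def)
    moreover have "of_int_point m = of_int_point a + of_int_point (m - a)"
      by (simp add: of_int_point_diff)
    ultimately show "of_int_point m \<in> cone_over (J \<oplus> K)"
      unfolding sum_iff by blast
  }
  assume "of_int_point m \<in> cone_over (J \<oplus> K)"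
  then obtain v s w t where vw: "(v, s) \<in> cone_over J" "(w, t) \<in> cone_over K"
    and m: "of_int_point m = (v + w, s + t)"
    unfolding sum_iff by (metis add_Pair surj_pair)
  have "integral_vec (v + w)"
    using integral_vec_fst_of_int_point[of m] m by simp
  then have v: "integral_vec v"
    using free_sum_integral_part[OF assms(4) vw[THEN cone_over_subset_span]] by blast
  obtain p where p: "p \<in> \<int>" "(v, p) \<in> cone_over J" "\<And>r. (v, r) \<in> cone_over J \<Longrightarrow> p \<le> r"
    using integral_least_height[OF assms(1,3) zero(1) env vw(1) v] by blast
  have "(v, p) \<in> int_lattice"
    using v p by (simp add: int_lattice_iff)
  then obtain a where a: "of_int_point a = (v, p)"
    unfolding int_lattice_def by force
  \<comment> \<open>The part in \<open>cone_over J\<close> is lowered to its least height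
    \<open>p\<close>. The excess \<open>s - p\<close>, nonnegative by minimality, is moved to the
    part in \<open>cone_over K\<close>, which tolerates any increase in height.\<close>
  have "(w, s + t - p) \<in> cone_over K"
    using cone_over_upward[OF assms(2) zero(2) vw(2)] p(3)[OF vw(1)] by simp
  then have "a \<in> splittings (cone_over J) (cone_over K) m"
    using p(2) by (simp add: splittings_def of_int_point_diff a m)
  moreover have "of_int_point a - e_last \<notin> cone_over J"
    using p(3)[of "p - 1"] by (auto simp: a e_last_def)
  ultimately show
    "\<exists>a \<in> splittings (cone_over J) (cone_over K) m. of_int_point a - e_last \<notin> cone_over J"
    by blast
qed

theorem theorem1p2:
  fixes J K :: "(real ^ 'n) set"
  assumes "convex J" and "convex K"
    and "compact J"
    and "is_free_sum J K"
    and "llenv (cone_over J) = lenv (cone_over J) \<inter> int_lattice"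
  shows "mult_defined (sigma_series (cone_over J)) (sigma_series (cone_over K)) \<and>
         sigma_series (cone_over (J \<oplus> K)) =
           (one_laurent - z_last) \<star>
             (sigma_series (cone_over J) \<star> sigma_series (cone_over K))"
proof
  note zero = free_sum_zero_mem[OF assms(4)]
  \<comment> \<open>The sets required to be finite are exactly the sets of splittings.\<close>
  show "mult_defined (sigma_series (cone_over J)) (sigma_series (cone_over K))"
    unfolding mult_defined_def sigma_series_support using finite_splittings[OF assms(4)] by blast
  show "sigma_series (cone_over (J \<oplus> K)) =
      (one_laurent - z_last) \<star> (sigma_series (cone_over J) \<star> sigma_series (cone_over K))"
  proof
    fix m :: "(int ^ 'n) \<times> int"
    let ?B = "{a \<in> splittings (cone_over J) (cone_over K) m. of_int_point a - e_last \<notin> cone_over J}"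
    have up: "x + e_last \<in> cone_over J" if "x \<in> cone_over J" for x
      using that cone_over_upward[OF assms(1) zero(1), of "fst x" "snd x" "snd x + 1"]
      by (cases x) (simp add: e_last_def)
    have "((one_laurent - z_last) \<star> (sigma_series (cone_over J) \<star> sigma_series (cone_over K))) m =
        int (card ?B)"
      unfolding one_minus_z_last_mult sigma_series_mult
      by (rule card_splittings_diff[OF finite_splittings[OF assms(4)] up])
    also have "\<dots> = sigma_series (cone_over (J \<oplus> K)) m"
    proof (cases "of_int_point m \<in> cone_over (J \<oplus> K)")
      case True
      then obtain a where "a \<in> ?B"
        using minimal_splitting_exists_iff[OF assms] by blast
      then have "?B = {a}"
        using minimal_splittings_unique[OF assms(1) zero(1) assms(4)] by blast
      then have "card ?B = 1" by simp
      with True show ?thesis by (simp add: sigma_series_def)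
    next
      case False
      then have "?B = {}"
        using minimal_splitting_exists_iff[OF assms] by blast
      then have "card ?B = 0" by (simp only: card.empty)
      with False show ?thesis by (simp add: sigma_series_def)
    qed
    finally show "sigma_series (cone_over (J \<oplus> K)) m =
      ((one_laurent - z_last) \<star> (sigma_series (cone_over J) \<star> sigma_series (cone_over K))) m"
      by simp
  qed
qed

end
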